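(* Assume that the $8$ coefficients $c_{n\ell}$ ($n=1,2$; $\ell=1,2,3,4$) of the dynamical system $$\dot x_n=c_{n1}x_1^3+c_{n2}x_1^2x_2+c_{n3}x_1x_2^2+c_{n4}x_2^3,\qquad n=1,2,$$ are given in terms of the $7$ a priori arbitrary (possibly complex) parameters $a_1,a_2,b_1,b_2,\gamma_1,\gamma_2,\gamma_3$ by the formulas $$c_{11}=\frac{a_1^3b_2-a_2K_1}{c},\quad c_{21}=\frac{-a_1^3b_1+a_1K_1}{c},\quad c_{12}=\frac{3a_1^2a_2b_2-a_2K_2}{c},\quad c_{22}=\frac{-3a_1^2a_2b_1+a_1K_2}{c},$$ $$c_{13}=\frac{3a_1a_2^2b_2-a_2K_3}{c},\quad c_{23}=\frac{-3a_1a_2^2b_1+a_1K_3}{c},\quad c_{14}=\frac{a_2^3b_2-a_2K_4}{c},\quad c_{24}=\frac{-a_2^3b_1+a_1K_4}{c},$$ where $c=a_1b_2-a_2b_1$ and $$K_1=\gamma_1a_1b_1^2+\gamma_2a_1^2b_1+\gamma_3a_1^3+b_1^3,$$ $$K_2=\gamma_1(a_2b_1^2+2a_1b_1b_2)+\gamma_2(a_1^2b_2+2a_1a_2b_1)+3\gamma_3a_1^2a_2+3b_1^2b_2,$$ $$K_3=\gamma_1(a_1b_2^2+2a_2b_1b_2)+\gamma_2(a_2^2b_1+2a_1a_2b_2)+3\gamma_3a_1a_2^2+3b_1b_2^2,$$ $$K_4=\gamma_1a_2b_2^2+\gamma_2a_2^2b_2+\gamma_3a_2^3+b_2^3.$$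 Then the initial-values problem for the system is solved by the formulas $$x_1(t)=\frac{b_2y(t)-a_2w(t)}{c},\qquad x_2(t)=-\frac{b_1y(t)-a_1w(t)}{c},$$ whose inversion reads $y(t)=a_1x_1(t)+a_2x_2(t)$, $w(t)=b_1x_1(t)+b_2x_2(t)$, so that in particular $y(0)=a_1x_1(0)+a_2x_2(0)$ and $w(0)=b_1x_1(0)+b_2x_2(0)$. Here $y(t)$ is given explicitly by $$y(t)=y(0)\,\{1-2[y(0)]^2t\}^{-1/2},$$ and $w(t)=u(t)\,y(t)$, where the function $u(t)$ is defined implicitly by $$\left[\frac{u(t)-u_1}{u(0)-u_1}\right]^{-2\lambda_1}\left[\frac{u(t)-u_2}{u(0)-u_2}\right]^{-2\lambda_2}\left[\frac{u(t)-u_3}{u(0)-u_3}\right]^{-2\lambda_3}=1-2[y(0)]^2t,\qquad u(0)=\frac{w(0)}{y(0)}.$$ The $6$ parameters $u_j$ and $\lambda_j$ ($j=1,2,3$) are defined in terms of $\gamma_1,\gamma_2,\gamma_3$ only: $u_1,u_2,u_3$ are the roots of the cubic polynomial $$u^3+\gamma_1u^2+(\gamma_2-1)u+\gamma_3=(u-u_1)(u-u_2)(u-u_3),$$ so that $\gamma_1=-(u_1+u_2+u_3)$, $\gamma_2=u_1u_2+u_2u_3+u_3u_1+1$, $\gamma_3=-u_1u_2u_3$ (and the $u_j$ are given explicitly in terms of the $\gamma_j$ by the Cardano formulas); and the $\lambda_j$ are determined by the three relations $$\lambda_1+\lambda_2+\lambda_3=0,\qquad \lambda_1u_1+\lambda_2u_2+\lambda_3u_3=0,\qquad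 \lambda_1u_2u_3+\lambda_2u_3u_1+\lambda_3u_1u_2=1,$$ implying $$\lambda_j=\Big[\prod_{\ell=1,\ \ell\neq j}^{3}(u_j-u_\ell)\Big]^{-1},\qquad j=1,2,3.$$
   Context: $x_1(t),x_2(t)$ are the (possibly complex) dependent variables, $t$ is the independent variable ("time", which may also be considered complex), and the dot denotes differentiation with respect to $t$. The coefficients $c_{n\ell}$ are time-independent and possibly complex; apart from being given by the stated formulas, they are generally assumed to have generic values. The initial data are $x_1(0),x_2(0)$, and the solutions $x_1(t),x_2(t)$ are identified by continuity in $t$ starting from these initial data. *)

theory Defs
  imports "HOL-Analysis.Analysis"
begin

text \<open>
  Time may be real or complex. In both cases it ranges over a set of complex numbers containing the
  initial time 0: a simply connected open set, or the copy of a real interval inside the complex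
  plane. On a set of the second kind, \<open>(f has_field_derivative d) (at t within D)\<close> is the
  derivative of a complex-valued function of the real variable (one-sided at an end point).
  Simple connectedness is what makes continuation of the powers below single-valued.
\<close>

definition time_domain :: "complex set \<Rightarrow> bool" where
  "time_domain D \<longleftrightarrow> 0 \<in> D \<and>
     ((open D \<and> simply_connected D) \<or> (\<exists>I. is_interval I \<and> D = complex_of_real ` I))"

definition solves_cubic_system ::
    "complex^4^2 \<Rightarrow> complex set \<Rightarrow> (complex \<Rightarrow> complex) \<Rightarrow> (complex \<Rightarrow> complex) \<Rightarrow> bool" where
  "solves_cubic_system C D x1 x2 \<longleftrightarrow> (\<forall>t\<in>D.
     (x1 has_field_derivative
        (C$1$1 * x1 t ^ 3 + C$1$2 * x1 t ^ 2 * x2 t + C$1$3 * x1 t * x2 t ^ 2 + C$1$4 * x2 t ^ 3))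
       (at t within D) \<and>
     (x2 has_field_derivative
        (C$2$1 * x1 t ^ 3 + C$2$2 * x1 t ^ 2 * x2 t + C$2$3 * x1 t * x2 t ^ 2 + C$2$4 * x2 t ^ 3))
       (at t within D))"

text \<open>
  \<open>power_branch D f \<alpha> h\<close>: on \<open>D\<close>, \<open>h\<close> is the power \<open>f\<^sup>\<alpha>\<close> continued continuously in \<open>t\<close> from the
  value 1 at \<open>t = 0\<close>. It forces \<open>f 0 = 1\<close> and \<open>f\<close> to have no zero on \<open>D\<close>, and on a connected \<open>D\<close>
  it determines \<open>h\<close>. The principal power \<open>powr\<close> would not do, because it jumps where \<open>f t\<close> crosses
  the negative real axis.
\<close>

definition power_branch ::
    "complex set \<Rightarrow> (complex \<Rightarrow> complex) \<Rightarrow> complex \<Rightarrow> (complex \<Rightarrow> complex) \<Rightarrow> bool" where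
  "power_branch D f \<alpha> h \<longleftrightarrow> (\<exists>L. continuous_on D L \<and> L 0 = 0 \<and>
     (\<forall>t\<in>D. exp (L t) = f t \<and> h t = exp (\<alpha> * L t)))"

definition explicit_y :: "complex \<Rightarrow> complex set \<Rightarrow> (complex \<Rightarrow> complex) \<Rightarrow> bool" where
  "explicit_y y0 D y \<longleftrightarrow> (\<exists>h. power_branch D (\<lambda>t. 1 - 2 * y0 ^ 2 * t) (- 1 / 2) h \<and>
     (\<forall>t\<in>D. y t = y0 * h t))"

definition implicit_u ::
    "complex^3 \<Rightarrow> complex^3 \<Rightarrow> complex \<Rightarrow> complex \<Rightarrow> complex set \<Rightarrow> (complex \<Rightarrow> complex) \<Rightarrow> bool" where
  "implicit_u r lam y0 w0 D u \<longleftrightarrow> continuous_on D u \<and> u 0 = w0 / y0 \<and>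
     (\<exists>p. (\<forall>j. power_branch D (\<lambda>t. (u t - r$j) / (u 0 - r$j)) (- 2 * lam$j) (p j)) \<and>
          (\<forall>t\<in>D. p 1 t * p 2 t * p 3 t = 1 - 2 * y0 ^ 2 * t))"

definition lambda_relations :: "complex^3 \<Rightarrow> complex^3 \<Rightarrow> bool" where
  "lambda_relations r lam \<longleftrightarrow>
     lam$1 + lam$2 + lam$3 = 0 \<and>
     lam$1 * r$1 + lam$2 * r$2 + lam$3 * r$3 = 0 \<and>
     lam$1 * r$2 * r$3 + lam$2 * r$3 * r$1 + lam$3 * r$1 * r$2 = 1"

text \<open>
  Cardano's radicals for \<open>z\<^sup>3 + A z\<^sup>2 + B z + E\<close>: with \<open>v = z + A/3\<close> the cubic becomes
  \<open>v\<^sup>3 + P v + Q\<close>, and \<open>S\<close>, \<open>T\<close> are cube roots of \<open>-Q/2 \<plusminus> \<delta>\<close>, where \<open>\<delta>\<close> is a square root of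
  \<open>(Q/2)\<^sup>2 + (P/3)\<^sup>3\<close>, matched so that \<open>S T = -P/3\<close>.
\<close>

definition cardano_radicals ::
    "complex \<Rightarrow> complex \<Rightarrow> complex \<Rightarrow> complex \<Rightarrow> complex \<Rightarrow> bool" where
  "cardano_radicals A B E S T \<longleftrightarrow>
     (let P = B - A ^ 2 / 3; Q = 2 * A ^ 3 / 27 - A * B / 3 + E in
        \<exists>\<delta>. \<delta> ^ 2 = (Q / 2) ^ 2 + (P / 3) ^ 3 \<and>
            S ^ 3 = - Q / 2 + \<delta> \<and> T ^ 3 = - Q / 2 - \<delta> \<and> S * T = - P / 3)"

definition cardano_roots :: "complex \<Rightarrow> complex \<Rightarrow> complex \<Rightarrow> complex set" where
  "cardano_roots A S T =
     (let \<omega> = cis (2 * pi / 3) in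
        {S + T - A / 3, \<omega> * S + \<omega> ^ 2 * T - A / 3, \<omega> ^ 2 * S + \<omega> * T - A / 3})"

end

theory Submission
  imports Defs "HOL-Complex_Analysis.Riemann_Mapping"
begin

text \<open>
  The formulas for the coefficients are what results when the triangular homogeneous system
  \<open>y' = y\<^sup>3\<close>, \<open>w' = w\<^sup>3 + \<gamma>\<^sub>1 y w\<^sup>2 + \<gamma>\<^sub>2 y\<^sup>2 w + \<gamma>\<^sub>3 y\<^sup>3\<close> is written in the coordinates
  \<open>y = a\<^sub>1 x\<^sub>1 + a\<^sub>2 x\<^sub>2\<close>, \<open>w = b\<^sub>1 x\<^sub>1 + b\<^sub>2 x\<^sub>2\<close>; the \<open>K\<^sub>l\<close> are the coefficients of the second right-hand
  side after this substitution. The first equation is solved by \<open>y\<close> alone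
  (\<open>explicit_y_iff_ode\<close>). By homogeneity the ratio \<open>u = w / y\<close> satisfies the separable equation
  \<open>u' = y\<^sup>2 (u - u\<^sub>1) (u - u\<^sub>2) (u - u\<^sub>3)\<close>, whose first integral, by partial fractions with
  coefficients \<open>\<lambda>\<^sub>j\<close>, is the implicit relation for \<open>u\<close> (\<open>implicit_u_iff_ode\<close>).

  Two points go beyond this calculation. The first is that it has to be an equivalence for solutions
  on a whole time domain, with all powers continued along the solution. From the differential
  equation to the formulas, each of the quantities \<open>y\<close> and \<open>u - u\<^sub>j\<close> satisfies a homogeneous linear
  equation along the solution, so that it is its initial value times the exponential of an
  antiderivative (\<open>linear_ode_exponential\<close>): this shows that it never vanishes and supplies the
  continuous logarithm. In the other direction \<open>u\<close> is merely continuous, but a differentiable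
  function of \<open>u\<close> with nonzero derivative is known to be differentiable in \<open>t\<close>, and hence so is \<open>u\<close>
  (\<open>has_field_derivative_cancel_outer\<close>).

  The second point is that the implicit relation determines a continuous \<open>u\<close>. Uniqueness on any
  time domain holds because the difference of two solutions satisfies a homogeneous linear equation
  with initial value 0 (\<open>implicit_u_unique\<close>). Existence near \<open>t = 0\<close> comes from inverting an
  antiderivative of \<open>1 / ((z - u\<^sub>1) (z - u\<^sub>2) (z - u\<^sub>3))\<close> (\<open>local_existence\<close>).
\<close>

section \<open>Calculus on a time domain\<close>

lemma time_domain_0: "time_domain D \<Longrightarrow> 0 \<in> D"
  by (simp add: time_domain_def)

lemma time_domain_cases:
  assumes "time_domain D"
  obtains "open D" "simply_connected D" | "convex D"
proof -
  have "convex (complex_of_real ` I)" if "is_interval I" for I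
    using that by (intro convex_linear_image bounded_linear.linear bounded_linear_of_real)
      (simp add: is_interval_convex_1)
  then show ?thesis
    using assms that unfolding time_domain_def by blast
qed

text \<open>
  The two kinds of time domain enter the argument only through the next two lemmas. An open simply
  connected set carries antiderivatives by homotopy invariance of the contour integral. A segment
  does so because it is convex: Cauchy's theorem for a triangle asks for holomorphy only in the
  interior, and the interior of a segment is empty.
\<close>

lemma antiderivative_on_time_domain:
  assumes D: "time_domain D" and f: "f holomorphic_on D"
  obtains F where "F 0 = 0" "\<And>t. t \<in> D \<Longrightarrow> (F has_field_derivative f t) (at t within D)"
proof -
  from D have "\<exists>F. \<forall>t\<in>D. (F has_field_derivative f t) (at t within D)"
  proof (cases rule: time_domain_cases)
    case 1
    then show ?thesis
      using f simply_connected_eq_global_primitive[of D] has_field_derivative_at_within by metis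
  next
    case 2
    have "f field_differentiable at x" if "x \<in> interior D - {}" for x
      using that f interior_subset[of D] at_within_interior[of x D]
      unfolding holomorphic_on_def by (metis Diff_empty subsetD)
    with holomorphic_convex_primitive[OF 2, of "{}" f] f
    show ?thesis
      by (metis finite.emptyI holomorphic_on_imp_continuous_on)
  qed
  then obtain F where F: "\<And>t. t \<in> D \<Longrightarrow> (F has_field_derivative f t) (at t within D)"
    by blast
  show ?thesis
  proof (rule that[of "\<lambda>t. F t - F 0"])
    show "((\<lambda>t. F t - F 0) has_field_derivative f t) (at t within D)" if "t \<in> D" for t
      using F[OF that] by (auto intro!: derivative_eq_intros)
  qed simp
qed

lemma constant_on_time_domain:
  assumes D: "time_domain D"
    and der: "\<And>t. t \<in> D \<Longrightarrow> (f has_field_derivative 0) (at t within D)"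
    and t: "t \<in> D"
  shows "f t = f (0::complex)"
  using D
proof (cases rule: time_domain_cases)
  case 1
  then have "\<And>x. x \<in> D \<Longrightarrow> (f has_field_derivative 0) (at x)"
    using der by (metis at_within_open)
  moreover have "continuous_on D f"
    using der by (rule DERIV_continuous_on)
  ultimately obtain k where "\<And>x. x \<in> D \<Longrightarrow> f x = k"
    using DERIV_zero_connected_constant[of D "{}" f] 1 simply_connected_imp_connected[of D] by auto
  then show ?thesis
    using t time_domain_0[OF D] by simp
next
  case 2
  then show ?thesis
    using has_field_derivative_zero_constant[of D f] der t time_domain_0[OF D] by metis
qed

lemma same_derivative_on_time_domain:
  assumes D: "time_domain D"
    and f: "\<And>t. t \<in> D \<Longrightarrow> (f has_field_derivative d t) (at t within D)"
    and g: "\<And>t. t \<in> D \<Longrightarrow> (g has_field_derivative d t) (at t within D)"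
    and init: "f 0 = g 0" and t: "t \<in> D"
  shows "f t = g (t::complex)"
proof -
  have "((\<lambda>t. f t - g t) has_field_derivative 0) (at t within D)" if "t \<in> D" for t
    using DERIV_diff[OF f[OF that] g[OF that]] by simp
  from constant_on_time_domain[OF D this t] show ?thesis
    using init by simp
qed

text \<open>
  The exponential form has two uses: a solution of a homogeneous linear equation vanishes everywhere
  or nowhere, and the integral \<open>G\<close> of the coefficient is a continuous logarithm of \<open>v / v 0\<close>, which
  is what a branch of a power is built from.
\<close>

lemma linear_ode_exponential:
  assumes D: "time_domain D" and g: "g holomorphic_on D"
    and v: "\<And>t. t \<in> D \<Longrightarrow> (v has_field_derivative g t * v t) (at t within D)"
  obtains G where "G 0 = 0" "\<And>t. t \<in> D \<Longrightarrow> (G has_field_derivative g t) (at t within D)"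
    "\<And>t. t \<in> D \<Longrightarrow> v t = v 0 * exp (G t)"
proof -
  obtain G where G0: "G 0 = 0"
    and G: "\<And>t. t \<in> D \<Longrightarrow> (G has_field_derivative g t) (at t within D)"
    using antiderivative_on_time_domain[OF D g] by blast
  have "((\<lambda>t. v t * exp (- G t)) has_field_derivative 0) (at t within D)" if "t \<in> D" for t
    using v[OF that] G[OF that]
    by (auto intro!: derivative_eq_intros simp: algebra_simps)
  from constant_on_time_domain[OF D this] have "v t * exp (- G t) = v 0" if "t \<in> D" for t
    using that G0 by simp
  then have "v t = v 0 * exp (G t)" if "t \<in> D" for t
    using that by (metis exp_minus_inverse mult.assoc mult.commute mult.right_neutral)
  with G0 G that show ?thesis by blast
qed

lemma has_field_derivative_imp_holomorphic_on:
  assumes "\<And>t. t \<in> D \<Longrightarrow> (f has_field_derivative d t) (at t within D)"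
  shows "f holomorphic_on D"
  using assms unfolding holomorphic_on_def field_differentiable_def by blast

text \<open>
  A continuous function that is only known through a differentiable function of it: the difference
  quotients of \<open>H \<circ> u\<close> and of \<open>u\<close> differ by the factor \<open>(H (u s) - H (u t)) / (u s - u t)\<close>, which
  tends to \<open>d\<close>. This turns the implicit relation into a differential equation without an appeal to
  the inverse function theorem, and so works at the points of a real interval as well.
\<close>

lemma has_field_derivative_cancel_outer:
  fixes u H :: "complex \<Rightarrow> complex"
  assumes u: "continuous (at t within D) u"
    and Hu: "((\<lambda>s. H (u s)) has_field_derivative m) (at t within D)"
    and H: "(H has_field_derivative d) (at (u t))" and d: "d \<noteq> 0"
  shows "(u has_field_derivative m / d) (at t within D)"
proof -
  obtain g where g: "\<And>z. H z - H (u t) = g z * (z - u t)" "isCont g (u t)" "g (u t) = d"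
    using H unfolding CARAT_DERIV by blast
  have "continuous (at t within D) (\<lambda>s. g (u s))"
    using u g(2) continuous_within_compose3 by blast
  then have lim: "((\<lambda>s. g (u s)) \<longlongrightarrow> d) (at t within D)"
    using g(3) by (simp add: continuous_within)
  then have "\<forall>\<^sub>F s in at t within D. g (u s) \<noteq> 0"
    using d tendsto_imp_eventually_ne by blast
  then have ev: "\<forall>\<^sub>F s in at t within D.
      ((H (u s) - H (u t)) / (s - t)) / g (u s) = (u s - u t) / (s - t)"
    by eventually_elim (simp add: g(1))
  have "((\<lambda>s. ((H (u s) - H (u t)) / (s - t)) / g (u s)) \<longlongrightarrow> m / d) (at t within D)"
    using Hu lim d unfolding has_field_derivative_iff by (intro tendsto_divide)
  then show ?thesis
    unfolding has_field_derivative_iff using ev by (rule Lim_transform_eventually)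
qed

lemma continuous_log_has_field_derivative:
  fixes L f :: "complex \<Rightarrow> complex"
  assumes L: "continuous_on D L" and e: "\<And>s. s \<in> D \<Longrightarrow> exp (L s) = f s" and t: "t \<in> D"
    and f: "(f has_field_derivative d) (at t within D)"
  shows "(L has_field_derivative d / f t) (at t within D)"
proof -
  have "((\<lambda>s. exp (L s)) has_field_derivative d) (at t within D)"
    using has_field_derivative_transform_within[OF f, of 1] e t by simp
  moreover have "continuous (at t within D) L"
    using L t by (simp add: continuous_on_eq_continuous_within)
  ultimately show ?thesis
    using has_field_derivative_cancel_outer[of t D L exp d "exp (L t)"] e[OF t] DERIV_exp[of "L t"]
      exp_not_eq_zero[of "L t"] by metis
qed

text \<open>
  A continuous logarithm coincides near each time with a shifted principal branch. Thus locally a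
  branch of a power of \<open>u - \<rho>\<close> is a holomorphic function of \<open>u\<close> alone.
\<close>

lemma continuous_log_locally_Ln:
  fixes L u :: "complex \<Rightarrow> complex"
  assumes L: "continuous_on D L" and e: "\<And>s. s \<in> D \<Longrightarrow> exp (L s) = (u s - \<rho>) / k" and t: "t \<in> D"
  shows "\<forall>\<^sub>F s in at t within D. L s = L t + Ln ((u s - \<rho>) / (u t - \<rho>))"
proof -
  have nz: "k \<noteq> 0" "u t - \<rho> \<noteq> 0"
    using e[OF t] exp_not_eq_zero[of "L t"] by auto
  have "((\<lambda>s. Im (L s - L t)) \<longlongrightarrow> 0) (at t within D)"
    using L t unfolding continuous_on_def by (auto intro!: tendsto_eq_intros)
  from tendstoD[OF this pi_gt_zero] have "\<forall>\<^sub>F s in at t within D. \<bar>Im (L s - L t)\<bar> < pi"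
    by (simp add: dist_real_def)
  moreover have "\<forall>\<^sub>F s in at t within D. s \<in> D"
    by (simp add: eventually_at_filter)
  ultimately show ?thesis
  proof eventually_elim
    case (elim s)
    have "exp (L s - L t) = (u s - \<rho>) / (u t - \<rho>)"
      using e[OF t] e[OF elim(2)] nz by (simp add: exp_diff)
    moreover have "Ln (exp (L s - L t)) = L s - L t"
      using elim(1) by (intro Ln_exp) (auto simp: abs_less_iff)
    ultimately show ?case by simp
  qed
qed

section \<open>The two factors of the flow\<close>

lemma exp_minus_half_power2: "exp (- 1 / 2 * z) ^ 2 = inverse (exp (z :: complex))"
proof -
  have "exp (- 1 / 2 * z) ^ 2 = exp (2 * (- 1 / 2 * z))"
    by (rule exp_double[symmetric])
  also have "2 * (- 1 / 2 * z) = - z"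
    by simp
  finally show ?thesis
    by (simp add: exp_minus)
qed

lemma explicit_y_power2:
  assumes "explicit_y y0 D y" and "t \<in> D"
  shows "1 - 2 * y0 ^ 2 * t \<noteq> 0" and "y t ^ 2 = y0 ^ 2 / (1 - 2 * y0 ^ 2 * t)"
proof -
  obtain L where L: "exp (L t) = 1 - 2 * y0 ^ 2 * t" and y: "y t = y0 * exp (- 1 / 2 * L t)"
    using assms unfolding explicit_y_def power_branch_def by metis
  show "1 - 2 * y0 ^ 2 * t \<noteq> 0"
    using L by (metis exp_not_eq_zero)
  show "y t ^ 2 = y0 ^ 2 / (1 - 2 * y0 ^ 2 * t)"
    unfolding y power_mult_distrib exp_minus_half_power2 L by (simp add: divide_inverse)
qed

lemma explicit_y_nonzero:
  assumes "explicit_y y0 D y" and "t \<in> D" and "y0 \<noteq> 0"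
  shows "y t \<noteq> 0"
  using explicit_y_power2[OF assms(1,2)] assms(3) by auto

lemma explicit_y_iff_ode:
  assumes D: "time_domain D"
  shows "explicit_y y0 D y \<longleftrightarrow>
    y 0 = y0 \<and> (\<forall>t\<in>D. (y has_field_derivative y t ^ 3) (at t within D))"
proof
  assume "explicit_y y0 D y"
  then obtain L where L: "continuous_on D L" "L 0 = 0"
    and e: "\<And>t. t \<in> D \<Longrightarrow> exp (L t) = 1 - 2 * y0 ^ 2 * t"
    and y: "\<And>t. t \<in> D \<Longrightarrow> y t = y0 * exp (- 1 / 2 * L t)"
    unfolding explicit_y_def power_branch_def by metis
  have "(y has_field_derivative y t ^ 3) (at t within D)" if t: "t \<in> D" for t
  proof -
    have "((\<lambda>t. 1 - 2 * y0 ^ 2 * t) has_field_derivative - 2 * y0 ^ 2) (at t within D)"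
      by (auto intro!: derivative_eq_intros)
    from continuous_log_has_field_derivative[OF L(1) e t this]
    have "(L has_field_derivative - 2 * y0 ^ 2 / exp (L t)) (at t within D)"
      using e[OF t] by simp
    then have "((\<lambda>t. y0 * exp (- 1 / 2 * L t)) has_field_derivative
        y0 * exp (- 1 / 2 * L t) * (y0 ^ 2 / exp (L t))) (at t within D)"
      by (auto intro!: derivative_eq_intros)
    moreover have "y0 * exp (- 1 / 2 * L t) * (y0 ^ 2 / exp (L t)) = y t ^ 3"
    proof -
      have "y0 ^ 2 / exp (L t) = y t ^ 2"
        unfolding y[OF t] power_mult_distrib exp_minus_half_power2 by (simp add: divide_inverse)
      then show ?thesis
        using y[OF t] by (simp add: power3_eq_cube power2_eq_square)
    qed
    ultimately have "((\<lambda>t. y0 * exp (- 1 / 2 * L t)) has_field_derivative y t ^ 3) (at t within D)"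
      by (simp only:)
    then show ?thesis
      using has_field_derivative_transform_within[of _ _ t D 1 y] t y by auto
  qed
  moreover have "y 0 = y0"
    using y[OF time_domain_0[OF D]] L(2) by simp
  ultimately show "y 0 = y0 \<and> (\<forall>t\<in>D. (y has_field_derivative y t ^ 3) (at t within D))"
    by blast
next
  assume "y 0 = y0 \<and> (\<forall>t\<in>D. (y has_field_derivative y t ^ 3) (at t within D))"
  then have y0: "y 0 = y0"
    and y: "\<And>t. t \<in> D \<Longrightarrow> (y has_field_derivative y t ^ 2 * y t) (at t within D)"
    by (auto simp: power3_eq_cube power2_eq_square)
  have "(\<lambda>t. y t ^ 2) holomorphic_on D"
    using has_field_derivative_imp_holomorphic_on[OF y] by (intro holomorphic_intros)
  then obtain Y where Y0: "Y 0 = 0"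
    and Y: "\<And>t. t \<in> D \<Longrightarrow> (Y has_field_derivative y t ^ 2) (at t within D)"
    and yY: "\<And>t. t \<in> D \<Longrightarrow> y t = y0 * exp (Y t)"
    using linear_ode_exponential[OF D _ y] unfolding y0 by blast
  have e: "exp (- 2 * Y t) = 1 - 2 * y0 ^ 2 * t" if "t \<in> D" for t
  proof (rule same_derivative_on_time_domain[OF D _ _ _ that])
    fix t assume t: "t \<in> D"
    have "y t ^ 2 * exp (- 2 * Y t) = y0 ^ 2"
      by (simp add: yY[OF t] power_mult_distrib exp_double[symmetric] exp_minus)
    then show "((\<lambda>t. exp (- 2 * Y t)) has_field_derivative - 2 * y0 ^ 2) (at t within D)"
      using Y[OF t] by (auto intro!: derivative_eq_intros simp: mult.commute)
    show "((\<lambda>t. 1 - 2 * y0 ^ 2 * t) has_field_derivative - 2 * y0 ^ 2) (at t within D)"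
      by (auto intro!: derivative_eq_intros)
  qed (use Y0 in simp)
  have "continuous_on D (\<lambda>t. - 2 * Y t)"
    using DERIV_continuous_on[OF Y] by (intro continuous_intros)
  with e Y0 have "power_branch D (\<lambda>t. 1 - 2 * y0 ^ 2 * t) (- 1 / 2) (\<lambda>t. exp (Y t))"
    unfolding power_branch_def by (intro exI[of _ "\<lambda>t. - 2 * Y t"]) auto
  with yY show "explicit_y y0 D y"
    unfolding explicit_y_def by blast
qed

lemma explicit_y_holomorphic_on:
  assumes "time_domain D" and "explicit_y y0 D y"
  shows "y holomorphic_on D"
proof -
  have "(y has_field_derivative y t ^ 3) (at t within D)" if "t \<in> D" for t
    using assms that by (simp add: explicit_y_iff_ode)
  then show ?thesis
    by (rule has_field_derivative_imp_holomorphic_on)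
qed

text \<open>
  The three relations say exactly that the \<open>\<lambda>\<^sub>j\<close> are the coefficients of the partial fraction
  expansion of \<open>1 / ((z - u\<^sub>1) (z - u\<^sub>2) (z - u\<^sub>3))\<close>: in the numerator they are the conditions on the
  coefficients of \<open>z\<^sup>2\<close>, \<open>z\<close> and \<open>1\<close>.
\<close>

lemma lambda_relations_partial_fractions:
  assumes "lambda_relations r lam"
  shows "lam$1 * ((z - r$2) * (z - r$3)) + lam$2 * ((z - r$3) * (z - r$1)) +
    lam$3 * ((z - r$1) * (z - r$2)) = 1"
  using assms unfolding lambda_relations_def by algebra

lemma implicit_u_logs:
  assumes "implicit_u r lam y0 w0 D u"
  shows "\<exists>L. (\<forall>j. continuous_on D (L j)) \<and> (\<forall>j. L j 0 = 0) \<and>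
    (\<forall>j. \<forall>t\<in>D. exp (L j t) = (u t - r$j) / (u 0 - r$j)) \<and>
    (\<forall>t\<in>D. exp (- 2 * (lam$1 * L 1 t + lam$2 * L 2 t + lam$3 * L 3 t)) = 1 - 2 * y0 ^ 2 * t)"
proof -
  obtain p where p: "\<And>j. power_branch D (\<lambda>t. (u t - r$j) / (u 0 - r$j)) (- 2 * lam$j) (p j)"
    and pp: "\<And>t. t \<in> D \<Longrightarrow> p 1 t * p 2 t * p 3 t = 1 - 2 * y0 ^ 2 * t"
    using assms unfolding implicit_u_def by blast
  obtain L where L: "\<And>j. continuous_on D (L j)" "\<And>j. L j 0 = 0"
    and Le: "\<And>j t. t \<in> D \<Longrightarrow> exp (L j t) = (u t - r$j) / (u 0 - r$j)"
    and Lp: "\<And>j t. t \<in> D \<Longrightarrow> p j t = exp (- 2 * lam$j * L j t)"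
    using p unfolding power_branch_def by metis
  have "exp (- 2 * (lam$1 * L 1 t + lam$2 * L 2 t + lam$3 * L 3 t)) = 1 - 2 * y0 ^ 2 * t"
    if "t \<in> D" for t
    using pp[OF that] Lp[OF that] by (simp add: algebra_simps exp_add[symmetric])
  with L Le show ?thesis by (intro exI[of _ L]) simp
qed

lemma implicit_u_imp_explicit_y:
  assumes u: "implicit_u r lam y0 w0 D u"
  shows "\<exists>y. explicit_y y0 D y"
proof -
  obtain L :: "3 \<Rightarrow> complex \<Rightarrow> complex" where L: "\<forall>j. continuous_on D (L j)" "\<forall>j. L j 0 = 0"
    and expM: "\<forall>t\<in>D. exp (- 2 * (lam$1 * L 1 t + lam$2 * L 2 t + lam$3 * L 3 t)) = 1 - 2 * y0 ^ 2 * t"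
    using implicit_u_logs[OF u] by blast
  define M where "M t = - 2 * (lam$1 * L 1 t + lam$2 * L 2 t + lam$3 * L 3 t)" for t
  have "continuous_on D M"
    unfolding M_def by (intro continuous_intros L[rule_format])
  with expM have "power_branch D (\<lambda>t. 1 - 2 * y0 ^ 2 * t) (- 1 / 2) (\<lambda>t. exp (- 1 / 2 * M t))"
    unfolding power_branch_def using L(2) by (intro exI[of _ M]) (simp add: M_def)
  then have "explicit_y y0 D (\<lambda>t. y0 * exp (- 1 / 2 * M t))"
    unfolding explicit_y_def by (intro exI conjI) (assumption, simp)
  then show ?thesis by blast
qed

lemma prod_remove_3:
  fixes f :: "3 \<Rightarrow> 'a::comm_monoid_mult"
  shows "prod f (UNIV - {1}) = f 2 * f 3" "prod f (UNIV - {2}) = f 3 * f 1"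
    "prod f (UNIV - {3}) = f 1 * f 2"
proof -
  have "UNIV - {1::3} = {2, 3}" "UNIV - {2::3} = {3, 1}" "UNIV - {3::3} = {1, 2}"
    using exhaust_3 by auto
  then show "prod f (UNIV - {1}) = f 2 * f 3" "prod f (UNIV - {2}) = f 3 * f 1"
    "prod f (UNIV - {3}) = f 1 * f 2"
    by simp_all
qed

text \<open>
  Separation of variables: \<open>du / ((u - u\<^sub>1) (u - u\<^sub>2) (u - u\<^sub>3)) = y\<^sup>2 dt\<close>. The left side integrates to
  \<open>\<Sum>\<^sub>j \<lambda>\<^sub>j log (u - u\<^sub>j)\<close> by partial fractions, and the right side to \<open>log (y / y0)\<close> because
  \<open>y' = y\<^sup>2 y\<close>; exponentiating \<open>-2\<close> times both gives the implicit relation, as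
  \<open>(y / y0)\<^sup>-\<^sup>2 = 1 - 2 y0\<^sup>2 t\<close>.
\<close>

lemma implicit_u_iff_ode:
  assumes D: "time_domain D" and lam: "lambda_relations r lam"
    and y: "explicit_y y0 D y" and u0: "\<And>j. w0 / y0 \<noteq> r$j"
  shows "implicit_u r lam y0 w0 D u \<longleftrightarrow> u 0 = w0 / y0 \<and>
    (\<forall>t\<in>D. (u has_field_derivative
      y t ^ 2 * ((u t - r$1) * (u t - r$2) * (u t - r$3))) (at t within D))"
proof
  assume im: "implicit_u r lam y0 w0 D u"
  then have u: "continuous_on D u" "u 0 = w0 / y0"
    unfolding implicit_u_def by blast+
  obtain L where L: "\<And>j. continuous_on D (L j)" "\<And>j. L j 0 = 0"
    and Le: "\<And>j t. t \<in> D \<Longrightarrow> exp (L j t) = (u t - r$j) / (u 0 - r$j)"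
    and expM: "\<And>t. t \<in> D \<Longrightarrow>
      exp (- 2 * (lam$1 * L 1 t + lam$2 * L 2 t + lam$3 * L 3 t)) = 1 - 2 * y0 ^ 2 * t"
    using implicit_u_logs[OF im] by blast
  define M where "M t = - 2 * (lam$1 * L 1 t + lam$2 * L 2 t + lam$3 * L 3 t)" for t
  have Mc: "continuous_on D M"
    unfolding M_def by (intro continuous_intros L)
  have Me: "exp (M t) = 1 - 2 * y0 ^ 2 * t" if "t \<in> D" for t
    unfolding M_def by (rule expM[OF that])
  have "(u has_field_derivative
      y t ^ 2 * ((u t - r$1) * (u t - r$2) * (u t - r$3))) (at t within D)" if t: "t \<in> D" for t
  proof -
    have nz: "u t - r$j \<noteq> 0" for j
      using Le[OF t, of j] exp_not_eq_zero[of "L j t"] by auto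
    define l where "l j z = Ln ((z - r$j) / (u t - r$j))" for j z
    define H where "H z = M t - 2 * (lam$1 * l 1 z + lam$2 * l 2 z + lam$3 * l 3 z)" for z
    define d where "d = - 2 * (lam$1 / (u t - r$1) + lam$2 / (u t - r$2) + lam$3 / (u t - r$3))"
    have dprod: "d * ((u t - r$1) * (u t - r$2) * (u t - r$3)) = - 2"
    proof -
      have "- 2 * (l1 / a + l2 / b + l3 / k) * (a * b * k) =
          - 2 * (l1 * (b * k) + l2 * (k * a) + l3 * (a * b))"
        if "a \<noteq> 0" "b \<noteq> 0" "k \<noteq> 0" for l1 l2 l3 a b k :: complex
        using that by (simp add: field_simps)
      from this[OF nz nz nz] show ?thesis
        unfolding d_def by (simp only: lambda_relations_partial_fractions[OF lam]) simp
    qed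
    have loc: "\<forall>\<^sub>F s in at t within D. L j s = L j t + l j (u s)" for j
      unfolding l_def using continuous_log_locally_Ln[where u = u, OF L(1) Le t] .
    have "\<forall>\<^sub>F s in at t within D. H (u s) = M s"
      using loc[of 1] loc[of 2] loc[of 3]
      by eventually_elim (simp add: H_def M_def algebra_simps)
    moreover have "H (u t) = M t"
      using nz by (simp add: H_def l_def)
    moreover have "(M has_field_derivative - 2 * y0 ^ 2 / exp (M t)) (at t within D)"
    proof -
      have "((\<lambda>t. 1 - 2 * y0 ^ 2 * t) has_field_derivative - 2 * y0 ^ 2) (at t within D)"
        by (auto intro!: derivative_eq_intros)
      from continuous_log_has_field_derivative[OF Mc Me t this] show ?thesis
        using Me[OF t] by simp
    qed
    ultimately have Hu: "((\<lambda>s. H (u s)) has_field_derivative - 2 * y0 ^ 2 / exp (M t)) (at t within D)"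
      using has_field_derivative_cong_eventually[of "\<lambda>s. H (u s)" M] by blast
    have "(l j has_field_derivative 1 / (u t - r$j)) (at (u t))" for j
      unfolding l_def using nz[of j] by (auto intro!: derivative_eq_intros simp: divide_inverse)
    from this[of 1] this[of 2] this[of 3] have H: "(H has_field_derivative d) (at (u t))"
      unfolding H_def d_def by (auto intro!: derivative_eq_intros simp: mult.commute)
    have "d \<noteq> 0"
      using dprod by auto
    have "continuous (at t within D) u"
      using u(1) t by (simp add: continuous_on_eq_continuous_within)
    from has_field_derivative_cancel_outer[OF this Hu H \<open>d \<noteq> 0\<close>]
    have "(u has_field_derivative - 2 * y0 ^ 2 / exp (M t) / d) (at t within D)" .
    moreover have "- 2 * y0 ^ 2 / exp (M t) / d = y t ^ 2 * (- 2 / d)"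
      using explicit_y_power2(2)[OF y t] Me[OF t] by simp
    moreover have "- 2 / d = (u t - r$1) * (u t - r$2) * (u t - r$3)"
      using dprod \<open>d \<noteq> 0\<close> by (simp add: field_simps)
    ultimately show ?thesis by (simp only:)
  qed
  with u(2) show "u 0 = w0 / y0 \<and> (\<forall>t\<in>D. (u has_field_derivative
      y t ^ 2 * ((u t - r$1) * (u t - r$2) * (u t - r$3))) (at t within D))"
    by blast
next
  assume "u 0 = w0 / y0 \<and> (\<forall>t\<in>D. (u has_field_derivative
      y t ^ 2 * ((u t - r$1) * (u t - r$2) * (u t - r$3))) (at t within D))"
  then have u0': "u 0 = w0 / y0" and u: "\<And>t. t \<in> D \<Longrightarrow> (u has_field_derivative
      y t ^ 2 * ((u t - r$1) * (u t - r$2) * (u t - r$3))) (at t within D)"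
    by blast+
  obtain LY where LY: "continuous_on D LY" "LY 0 = 0"
    and LYe: "\<And>t. t \<in> D \<Longrightarrow> exp (LY t) = 1 - 2 * y0 ^ 2 * t"
    using y unfolding explicit_y_def power_branch_def by metis
  have hol: "y holomorphic_on D" "u holomorphic_on D"
    using explicit_y_holomorphic_on[OF D y] has_field_derivative_imp_holomorphic_on[OF u] by auto
  define cof where
    "cof j t = (\<Prod>l\<in>UNIV - {j}. u t - r$l)" for j :: 3 and t
  have cof: "cof 1 t = (u t - r$2) * (u t - r$3)" "cof 2 t = (u t - r$3) * (u t - r$1)"
      "cof 3 t = (u t - r$1) * (u t - r$2)" for t
    by (simp_all add: cof_def prod_remove_3)
  have "\<exists>L. L 0 = 0 \<and>
      (\<forall>t\<in>D. (L has_field_derivative y t ^ 2 * cof j t) (at t within D)) \<and>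
      (\<forall>t\<in>D. u t - r$j = (u 0 - r$j) * exp (L t))" for j
  proof -
    have "(\<lambda>t. y t ^ 2 * cof j t) holomorphic_on D"
      unfolding cof_def by (intro holomorphic_intros hol)
    moreover have "((\<lambda>t. u t - r$j) has_field_derivative y t ^ 2 * cof j t * (u t - r$j))
        (at t within D)" if "t \<in> D" for t
    proof -
      have "cof j t * (u t - r$j) = (u t - r$1) * (u t - r$2) * (u t - r$3)"
        using exhaust_3[of j] by (auto simp: cof)
      then show ?thesis
        using u[OF that] by (auto intro!: derivative_eq_intros simp: mult.assoc)
    qed
    ultimately obtain G where "G 0 = 0"
      "\<And>t. t \<in> D \<Longrightarrow> (G has_field_derivative y t ^ 2 * cof j t) (at t within D)"
      "\<And>t. t \<in> D \<Longrightarrow> u t - r$j = (u 0 - r$j) * exp (G t)"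
      using linear_ode_exponential[OF D, of "\<lambda>t. y t ^ 2 * cof j t" "\<lambda>t. u t - r$j"] by blast
    then show ?thesis
      by (intro exI[of _ G]) simp
  qed
  then obtain L where L0: "\<And>j. L j 0 = 0"
    and L: "\<And>j t. t \<in> D \<Longrightarrow> (L j has_field_derivative y t ^ 2 * cof j t) (at t within D)"
    and Lu: "\<And>j t. t \<in> D \<Longrightarrow> u t - r$j = (u 0 - r$j) * exp (L j t)"
    by metis
  define p where "p j t = exp (- 2 * lam$j * L j t)" for j t
  have "power_branch D (\<lambda>t. (u t - r$j) / (u 0 - r$j)) (- 2 * lam$j) (p j)" for j
    unfolding power_branch_def p_def
    using DERIV_continuous_on[OF L[of _ j]] L0 Lu u0[of j] u0'
    by (intro exI[of _ "L j"]) auto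
  moreover have "p 1 t * p 2 t * p 3 t = 1 - 2 * y0 ^ 2 * t" if t: "t \<in> D" for t
  proof -
    have "- 2 * (lam$1 * L 1 t + lam$2 * L 2 t + lam$3 * L 3 t) = LY t"
    proof (rule same_derivative_on_time_domain[OF D _ _ _ t])
      fix s assume s: "s \<in> D"
      have "lam$1 * cof 1 s + lam$2 * cof 2 s + lam$3 * cof 3 s = 1"
        unfolding cof by (rule lambda_relations_partial_fractions[OF lam])
      then have "- 2 * (lam$1 * (y s ^ 2 * cof 1 s) + lam$2 * (y s ^ 2 * cof 2 s)
          + lam$3 * (y s ^ 2 * cof 3 s)) = - 2 * y s ^ 2"
        by algebra
      then show "((\<lambda>t. - 2 * (lam$1 * L 1 t + lam$2 * L 2 t + lam$3 * L 3 t))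
          has_field_derivative - 2 * y s ^ 2) (at s within D)"
        using L[OF s] by (auto intro!: derivative_eq_intros simp: ac_simps)
      have "((\<lambda>t. 1 - 2 * y0 ^ 2 * t) has_field_derivative - 2 * y0 ^ 2) (at s within D)"
        by (auto intro!: derivative_eq_intros)
      from continuous_log_has_field_derivative[OF LY(1) LYe s this]
      have "(LY has_field_derivative - 2 * y0 ^ 2 / exp (LY s)) (at s within D)"
        using LYe[OF s] by simp
      moreover have "y s ^ 2 = y0 ^ 2 / exp (LY s)"
        using explicit_y_power2(2)[OF y s] LYe[OF s] by simp
      ultimately show "(LY has_field_derivative - 2 * y s ^ 2) (at s within D)"
        by simp
    qed (simp add: L0 LY)
    then show ?thesis
      using LYe[OF t] by (simp add: p_def algebra_simps exp_add[symmetric])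
  qed
  moreover have "continuous_on D u"
    using hol(2) by (rule holomorphic_on_imp_continuous_on)
  ultimately show "implicit_u r lam y0 w0 D u"
    unfolding implicit_u_def using u0' by blast
qed

lemma implicit_u_unique:
  assumes D: "time_domain D" and lam: "lambda_relations r lam" and u0: "\<And>j. w0 / y0 \<noteq> r$j"
    and u: "implicit_u r lam y0 w0 D u" and v: "implicit_u r lam y0 w0 D v" and t: "t \<in> D"
  shows "u t = v t"
proof -
  obtain y where y: "explicit_y y0 D y"
    using implicit_u_imp_explicit_y[OF u] by blast
  note ode = implicit_u_iff_ode[OF D lam y u0]
  define P where "P z = (z - r$1) * (z - r$2) * (z - r$3)" for z
  \<comment> \<open>The divided difference of \<open>P\<close>.\<close>
  define Q where "Q a b = (a - r$2) * (a - r$3) + (b - r$1) * (a - r$3) + (b - r$1) * (b - r$2)" for a b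
  have PQ: "P a - P b = Q a b * (a - b)" for a b
    unfolding P_def Q_def by (simp add: algebra_simps)
  have du: "(u has_field_derivative y t ^ 2 * P (u t)) (at t within D)"
    and dv: "(v has_field_derivative y t ^ 2 * P (v t)) (at t within D)" if "t \<in> D" for t
    using u v that unfolding ode P_def by auto
  note hol = explicit_y_holomorphic_on[OF D y]
    has_field_derivative_imp_holomorphic_on[OF du] has_field_derivative_imp_holomorphic_on[OF dv]
  have "(\<lambda>t. y t ^ 2 * Q (u t) (v t)) holomorphic_on D"
    unfolding Q_def by (intro holomorphic_intros hol)
  moreover have "((\<lambda>t. u t - v t) has_field_derivative y t ^ 2 * Q (u t) (v t) * (u t - v t))
      (at t within D)" if "t \<in> D" for t
    using DERIV_diff[OF du[OF that] dv[OF that]] PQ[of "u t" "v t"]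
    by (simp add: right_diff_distrib[symmetric] mult.assoc)
  ultimately obtain G where "\<And>t. t \<in> D \<Longrightarrow> u t - v t = (u 0 - v 0) * exp (G t)"
    by (rule linear_ode_exponential[OF D]) blast+
  moreover have "u 0 = v 0"
    using u v unfolding implicit_u_def by simp
  ultimately show ?thesis
    using t by simp
qed

text \<open>
  Away from the zeros of \<open>f\<close>, a solution of the autonomous equation is a local inverse of an
  antiderivative of \<open>1 / f\<close>.
\<close>

lemma autonomous_ode_local_solution:
  fixes f :: "complex \<Rightarrow> complex"
  assumes f: "f holomorphic_on UNIV" and nz: "f z0 \<noteq> 0"
  obtains e U where "e > 0" "U 0 = z0"
    "\<And>s. s \<in> ball 0 e \<Longrightarrow> (U has_field_derivative f (U s)) (at s)"
proof -
  have "isCont f z0"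
    using holomorphic_on_imp_continuous_on[OF f] continuous_on_eq_continuous_at[OF open_UNIV, of f]
    by blast
  then obtain \<rho> where \<rho>: "\<rho> > 0" "\<And>z. z \<in> ball z0 \<rho> \<Longrightarrow> f z \<noteq> 0"
    using continuous_at_avoid[of z0 f 0] nz by (auto simp: dist_commute)
  have "(\<lambda>z. 1 / f z) holomorphic_on ball z0 \<rho>"
    using \<rho>(2) f by (intro holomorphic_intros holomorphic_on_subset[OF f]) auto
  then obtain G0 where G0: "\<And>z. z \<in> ball z0 \<rho> \<Longrightarrow> (G0 has_field_derivative 1 / f z) (at z)"
    using holomorphic_convex_primitive'[of "ball z0 \<rho>" "\<lambda>z. 1 / f z"]
    by (metis convex_ball open_ball at_within_open)
  define G where "G z = G0 z - G0 z0" for z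
  have G: "(G has_field_derivative 1 / f z) (at z)" if "z \<in> ball z0 \<rho>" for z
    unfolding G_def using G0[OF that] by (auto intro!: derivative_eq_intros)
  then have Ghol: "G holomorphic_on ball z0 \<rho>"
    by (meson has_field_derivative_at_within has_field_derivative_imp_holomorphic_on)
  have "deriv G z0 \<noteq> 0"
    using DERIV_imp_deriv[OF G, of z0] \<rho>(1) nz by simp
  then obtain \<sigma> where \<sigma>: "\<sigma> > 0" "ball z0 \<sigma> \<subseteq> ball z0 \<rho>" "inj_on G (ball z0 \<sigma>)"
    using has_complex_derivative_locally_injective[OF Ghol, of z0] \<rho>(1) by auto
  have Gs: "G holomorphic_on ball z0 \<sigma>"
    using Ghol \<sigma>(2) holomorphic_on_subset by blast
  obtain U where U: "U holomorphic_on G ` ball z0 \<sigma>"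
      "\<And>z. z \<in> ball z0 \<sigma> \<Longrightarrow> deriv G z * deriv U (G z) = 1"
      "\<And>z. z \<in> ball z0 \<sigma> \<Longrightarrow> U (G z) = z"
    using holomorphic_has_inverse[OF Gs open_ball \<sigma>(3)] by blast
  have op: "open (G ` ball z0 \<sigma>)"
    using open_mapping_thm3[OF Gs open_ball \<sigma>(3)] .
  have Gz0: "G z0 = 0"
    by (simp add: G_def)
  have "0 \<in> G ` ball z0 \<sigma>"
    using \<sigma>(1) Gz0 by (metis centre_in_ball imageI)
  then obtain e where e: "e > 0" "ball 0 e \<subseteq> G ` ball z0 \<sigma>"
    using op open_contains_ball by blast
  show ?thesis
  proof (rule that[of e U])
    show "e > 0" by fact
    show "U 0 = z0"
      using U(3)[of z0] \<sigma>(1) Gz0 by simp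
    show "(U has_field_derivative f (U s)) (at s)" if s: "s \<in> ball 0 e" for s
    proof -
      obtain z where z: "z \<in> ball z0 \<sigma>" "s = G z"
        using s e(2) by blast
      then have "1 / f z * deriv U s = 1"
        using U(2) DERIV_imp_deriv[OF G] \<sigma>(2) by (metis subsetD)
      then have "deriv U s = f (U s)"
        using z U(3) \<rho>(2) \<sigma>(2) by (auto simp: field_simps)
      then show ?thesis
        using U(1) op z by (metis holomorphic_derivI imageI)
    qed
  qed
qed

text \<open>
  The factor \<open>y\<^sup>2\<close> is removed by passing to the new time \<open>-log (1 - 2 y0\<^sup>2 t) / 2\<close>, whose derivative
  is \<open>y\<^sup>2\<close>.
\<close>

lemma local_existence:
  assumes lam: "lambda_relations r lam" and u0: "\<And>j. w0 / y0 \<noteq> r$j"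
  shows "\<exists>R>0. (\<exists>y. explicit_y y0 (ball 0 R) y) \<and> (\<exists>u. implicit_u r lam y0 w0 (ball 0 R) u)"
proof -
  define f where "f z = (z - r$1) * (z - r$2) * (z - r$3)" for z
  have "f holomorphic_on UNIV"
    unfolding f_def by (intro holomorphic_intros)
  moreover have "f (w0 / y0) \<noteq> 0"
    using u0 by (simp add: f_def)
  ultimately obtain e U where e: "e > 0" and U0: "U 0 = w0 / y0"
    and U: "\<And>s. s \<in> ball 0 e \<Longrightarrow> (U has_field_derivative f (U s)) (at s)"
    by (rule autonomous_ode_local_solution) blast
  define \<tau> where "\<tau> t = - Ln (1 - 2 * y0 ^ 2 * t) / 2" for t
  have "isCont (\<lambda>t. 1 - 2 * y0 ^ 2 * t) 0"
    by (intro continuous_intros)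
  then obtain R1 where R1: "R1 > 0"
    "\<And>t. norm t < R1 \<Longrightarrow> norm ((1 - 2 * y0 ^ 2 * t) - 1) < 1"
    unfolding continuous_at_eps_delta by (auto simp: dist_norm dest: spec[of _ "1::real"])
  have slit: "z \<notin> \<real>\<^sub>\<le>\<^sub>0" if "norm (z - 1) < 1" for z :: complex
    using that abs_Re_le_cmod[of "z - 1"] by (simp add: complex_nonpos_Reals_iff)
  have pos: "1 - 2 * y0 ^ 2 * t \<notin> \<real>\<^sub>\<le>\<^sub>0" if "norm t < R1" for t
    by (rule slit[OF R1(2)[OF that]])
  have "isCont \<tau> 0"
    unfolding \<tau>_def using pos[of 0] R1(1) by (intro continuous_intros) auto
  then have "(\<tau> \<longlongrightarrow> \<tau> 0) (nhds 0)"
    by (simp add: continuous_at tendsto_at_iff_tendsto_nhds)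
  from tendstoD[OF this e] have "\<forall>\<^sub>F t in nhds 0. norm (\<tau> t) < e"
    by (simp add: \<tau>_def)
  then obtain R2 where R2: "R2 > 0" "\<And>t. norm t < R2 \<Longrightarrow> norm (\<tau> t) < e"
    unfolding eventually_nhds_metric by auto
  define R where "R = min R1 R2"
  have R: "R > 0" using R1(1) R2(1) by (simp add: R_def)
  have D: "time_domain (ball 0 R)"
    using R by (simp add: time_domain_def convex_imp_simply_connected)
  define y where "y t = y0 * exp (\<tau> t)" for t
  have "power_branch (ball 0 R) (\<lambda>t. 1 - 2 * y0 ^ 2 * t) (- 1 / 2) (\<lambda>t. exp (\<tau> t))"
    unfolding power_branch_def
  proof (intro exI[of _ "\<lambda>t. Ln (1 - 2 * y0 ^ 2 * t)"] conjI ballI)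
    show "continuous_on (ball 0 R) (\<lambda>t. Ln (1 - 2 * y0 ^ 2 * t))"
      using pos by (intro continuous_intros) (auto simp: R_def)
    show "exp (Ln (1 - 2 * y0 ^ 2 * t)) = 1 - 2 * y0 ^ 2 * t" if "t \<in> ball 0 R" for t
      using pos[of t] that by (intro exp_Ln) (auto simp: R_def)
  qed (auto simp: \<tau>_def)
  then have y: "explicit_y y0 (ball 0 R) y"
    unfolding explicit_y_def y_def by blast
  have \<tau>': "(\<tau> has_field_derivative y t ^ 2) (at t)" if t: "t \<in> ball 0 R" for t
  proof -
    have p: "1 - 2 * y0 ^ 2 * t \<notin> \<real>\<^sub>\<le>\<^sub>0"
      using t by (intro pos) (simp add: R_def)
    have "((\<lambda>t. - Ln (1 - 2 * y0 ^ 2 * t) / 2) has_field_derivative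
        - (inverse (1 - 2 * y0 ^ 2 * t) * (- (2 * y0 ^ 2))) / 2) (at t)"
      by (intro DERIV_cdivide DERIV_minus DERIV_chain2[of Ln] has_field_derivative_Ln[OF p])
        (auto intro!: derivative_eq_intros)
    moreover have "- (inverse q * (- (2 * b))) / 2 = b / q" for q b :: complex
      by (simp add: field_simps)
    ultimately show ?thesis
      unfolding \<tau>_def explicit_y_power2(2)[OF y t] by (simp only:)
  qed
  have "((\<lambda>t. U (\<tau> t)) has_field_derivative y t ^ 2 * f (U (\<tau> t))) (at t within ball 0 R)"
    if t: "t \<in> ball 0 R" for t
  proof -
    have "\<tau> t \<in> ball 0 e"
      using t R2(2)[of t] by (simp add: R_def)
    from DERIV_chain2[OF U[OF this] \<tau>'[OF t]]
    have "((\<lambda>t. U (\<tau> t)) has_field_derivative y t ^ 2 * f (U (\<tau> t))) (at t)"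
      by (simp only: mult.commute)
    then show ?thesis
      by (rule has_field_derivative_at_within)
  qed
  moreover have "U (\<tau> 0) = w0 / y0"
    by (simp add: \<tau>_def U0)
  ultimately have "implicit_u r lam y0 w0 (ball 0 R) (\<lambda>t. U (\<tau> t))"
    unfolding implicit_u_iff_ode[OF D lam y u0] f_def by blast
  with y R show ?thesis by blast
qed

section \<open>Cardano's formulas and the partial fraction coefficients\<close>

lemma cardano_radicals_exist: "\<exists>S T. cardano_radicals A B E S T"
proof -
  define P where "P = B - A ^ 2 / 3"
  define Q where "Q = 2 * A ^ 3 / 27 - A * B / 3 + E"
  define \<delta> where "\<delta> = csqrt ((Q / 2) ^ 2 + (P / 3) ^ 3)"
  have \<delta>: "\<delta> ^ 2 = (Q / 2) ^ 2 + (P / 3) ^ 3"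
    by (simp add: \<delta>_def)
  then have prod: "(- Q / 2 + \<delta>) * (- Q / 2 - \<delta>) = (- P / 3) ^ 3"
    by (simp add: field_simps power2_eq_square power3_eq_cube)
  obtain S where S: "S ^ 3 = - Q / 2 + \<delta>"
    using exists_complex_root[of 3] by (metis zero_neq_numeral)
  have "\<exists>T. T ^ 3 = - Q / 2 - \<delta> \<and> S * T = - P / 3"
  proof (cases "S = 0")
    case True
    obtain T where T: "T ^ 3 = - Q / 2 - \<delta>"
      using exists_complex_root[of 3] by (metis zero_neq_numeral)
    have "P = 0"
      using prod unfolding S[symmetric] True by simp
    with True T show ?thesis by auto
  next
    case False
    \<comment> \<open>The value of \<open>T\<close> is forced by the matching condition; that its cube is right is \<open>prod\<close>.\<close>
    have "S ^ 3 * (- P / 3 / S) ^ 3 = S ^ 3 * (- Q / 2 - \<delta>)"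
      using False prod unfolding S[symmetric] by (simp add: power_divide)
    then have "(- P / 3 / S) ^ 3 = - Q / 2 - \<delta>"
      unfolding mult_cancel_left using False by simp
    moreover have "S * (- P / 3 / S) = - P / 3"
      using False by simp
    ultimately show ?thesis by blast
  qed
  with \<delta> S show ?thesis
    unfolding cardano_radicals_def Let_def P_def Q_def by blast
qed

lemma cardano_roots_iff:
  assumes "cardano_radicals A B E S T"
  shows "z \<in> cardano_roots A S T \<longleftrightarrow> z ^ 3 + A * z ^ 2 + B * z + E = 0"
proof -
  define P where "P = B - A ^ 2 / 3"
  define Q where "Q = 2 * A ^ 3 / 27 - A * B / 3 + E"
  define \<omega> where "\<omega> = cis (2 * pi / 3)"
  define v where "v = z + A / 3"
  have ST: "S * T = - P / 3" "S ^ 3 + T ^ 3 = - Q"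
    using assms unfolding cardano_radicals_def Let_def P_def Q_def by auto
  have \<omega>: "\<omega> ^ 2 + \<omega> + 1 = 0"
    by (simp add: \<omega>_def complex_eq_iff power2_eq_square cos_120 sin_120)
  have "z ^ 3 + A * z ^ 2 + B * z + E = v ^ 3 + P * v + Q"
    by (simp add: v_def P_def Q_def field_simps power2_eq_square power3_eq_cube)
  also have "\<dots> = v ^ 3 - 3 * (S * T) * v - (S ^ 3 + T ^ 3)"
    unfolding ST by simp
  also have "\<dots> = (v - (S + T)) * (v - (\<omega> * S + \<omega> ^ 2 * T)) * (v - (\<omega> ^ 2 * S + \<omega> * T))"
    using \<omega> by algebra
  finally have factored: "z ^ 3 + A * z ^ 2 + B * z + E = \<dots>" .
  have "z = s - A / 3 \<longleftrightarrow> v - s = 0" for s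
    by (auto simp: v_def)
  then show ?thesis
    unfolding cardano_roots_def Let_def \<omega>_def[symmetric] factored by simp
qed

text \<open>
  Evaluating the partial fraction identity at the roots gives the residues \<open>\<lambda>\<^sub>j\<close>. Conversely, multiplied
  by the Vandermonde product \<open>V\<close> the residues become differences of roots, for which the three
  relations are polynomial identities.
\<close>

lemma lambda_relations_iff:
  fixes r lam :: "complex^3"
  assumes "r$1 \<noteq> r$2" "r$2 \<noteq> r$3" "r$3 \<noteq> r$1"
  shows "lambda_relations r lam \<longleftrightarrow> (\<forall>j. lam$j = inverse (\<Prod>l\<in>UNIV - {j}. r$j - r$l))"
proof
  assume lam: "lambda_relations r lam"
  have "lam$1 * ((r$1 - r$2) * (r$1 - r$3)) = 1" "lam$2 * ((r$2 - r$3) * (r$2 - r$1)) = 1"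
    "lam$3 * ((r$3 - r$1) * (r$3 - r$2)) = 1"
    using lambda_relations_partial_fractions[OF lam, of "r$1"]
      lambda_relations_partial_fractions[OF lam, of "r$2"]
      lambda_relations_partial_fractions[OF lam, of "r$3"] by simp_all
  then show "\<forall>j. lam$j = inverse (\<Prod>l\<in>UNIV - {j}. r$j - r$l)"
    unfolding forall_3 prod_remove_3 by (metis inverse_unique mult.commute)
next
  have cleared: "l1 + l2 + l3 = 0 \<and> l1 * a + l2 * b + l3 * k = 0 \<and> l1 * b * k + l2 * k * a + l3 * a * b = 1"
    if "l1 = inverse ((a - b) * (a - k))" "l2 = inverse ((b - k) * (b - a))"
      "l3 = inverse ((k - a) * (k - b))" and ne: "a \<noteq> b" "b \<noteq> k" "k \<noteq> a" for l1 l2 l3 a b k :: complex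
  proof -
    define V where "V = (a - b) * (b - k) * (k - a)"
    have V: "V \<noteq> 0" using ne by (simp add: V_def)
    have "l1 * ((a - b) * (a - k)) = 1" "l2 * ((b - k) * (b - a)) = 1"
      "l3 * ((k - a) * (k - b)) = 1"
      unfolding that(1-3) using ne by (simp_all del: inverse_mult_distrib)
    then have l: "l1 * V = k - b" "l2 * V = a - k" "l3 * V = b - a"
      unfolding V_def by algebra+
    have "(l1 + l2 + l3) * V = 0" "(l1 * a + l2 * b + l3 * k) * V = 0"
      "(l1 * b * k + l2 * k * a + l3 * a * b) * V = 1 * V"
      using l unfolding V_def by algebra+
    with V show ?thesis
      unfolding mult_cancel_right by simp
  qed
  assume "\<forall>j. lam$j = inverse (\<Prod>l\<in>UNIV - {j}. r$j - r$l)"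
  then show "lambda_relations r lam"
    unfolding lambda_relations_def forall_3 prod_remove_3 using assms by (intro cleared) simp_all
qed

lemma lambda_relations_ex1:
  fixes r :: "complex^3"
  assumes "r$1 \<noteq> r$2" "r$2 \<noteq> r$3" "r$3 \<noteq> r$1"
  shows "\<exists>!lam. lambda_relations r lam"
proof (rule ex1I[of _ "\<chi> j. inverse (\<Prod>l\<in>UNIV - {j}. r$j - r$l)"])
  show "lambda_relations r (\<chi> j. inverse (\<Prod>l\<in>UNIV - {j}. r$j - r$l))"
    unfolding lambda_relations_iff[OF assms] by simp
  show "lam = (\<chi> j. inverse (\<Prod>l\<in>UNIV - {j}. r$j - r$l))" if "lambda_relations r lam" for lam
    using that unfolding lambda_relations_iff[OF assms] by (simp add: vec_eq_iff)
qed

section \<open>The initial-value problem for the cubic system\<close>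

theorem mainTheorem1:
  fixes a1 a2 b1 b2 g1 g2 g3 c K1 K2 K3 K4 :: complex
    and C :: "complex^4^2" and r :: "complex^3"
  assumes c: "c = a1 * b2 - a2 * b1" and c_nonzero: "c \<noteq> 0"
    and K1: "K1 = g1 * a1 * b1^2 + g2 * a1^2 * b1 + g3 * a1^3 + b1^3"
    and K2: "K2 = g1 * (a2 * b1^2 + 2 * a1 * b1 * b2) + g2 * (a1^2 * b2 + 2 * a1 * a2 * b1)
                  + 3 * g3 * a1^2 * a2 + 3 * b1^2 * b2"
    and K3: "K3 = g1 * (a1 * b2^2 + 2 * a2 * b1 * b2) + g2 * (a2^2 * b1 + 2 * a1 * a2 * b2)
                  + 3 * g3 * a1 * a2^2 + 3 * b1 * b2^2"
    and K4: "K4 = g1 * a2 * b2^2 + g2 * a2^2 * b2 + g3 * a2^3 + b2^3"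
    and c11: "C$1$1 = (a1^3 * b2 - a2 * K1) / c"
    and c21: "C$2$1 = (- (a1^3) * b1 + a1 * K1) / c"
    and c12: "C$1$2 = (3 * a1^2 * a2 * b2 - a2 * K2) / c"
    and c22: "C$2$2 = (- 3 * a1^2 * a2 * b1 + a1 * K2) / c"
    and c13: "C$1$3 = (3 * a1 * a2^2 * b2 - a2 * K3) / c"
    and c23: "C$2$3 = (- 3 * a1 * a2^2 * b1 + a1 * K3) / c"
    and c14: "C$1$4 = (a2^3 * b2 - a2 * K4) / c"
    and c24: "C$2$4 = (- (a2^3) * b1 + a1 * K4) / c"
    and roots: "\<And>z. z^3 + g1 * z^2 + (g2 - 1) * z + g3 = (z - r$1) * (z - r$2) * (z - r$3)"
    and roots_distinct: "r$1 \<noteq> r$2" "r$2 \<noteq> r$3" "r$3 \<noteq> r$1"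
  shows
    "g1 = - (r$1 + r$2 + r$3) \<and>
     g2 = r$1 * r$2 + r$2 * r$3 + r$3 * r$1 + 1 \<and>
     g3 = - (r$1 * r$2 * r$3) \<and>
     (\<exists>S T. cardano_radicals g1 (g2 - 1) g3 S T) \<and>
     (\<forall>S T. cardano_radicals g1 (g2 - 1) g3 S T \<longrightarrow> {r$1, r$2, r$3} = cardano_roots g1 S T) \<and>
     (\<exists>!lam. lambda_relations r lam) \<and>
     (\<forall>lam. lambda_relations r lam \<longrightarrow>
        (\<forall>j. lam$j = inverse (\<Prod>l\<in>UNIV - {j}. r$j - r$l))) \<and>
     (\<forall>X1 X2 Y W.
        X1 = (b2 * Y - a2 * W) / c \<and> X2 = - (b1 * Y - a1 * W) / c
        \<longleftrightarrow> Y = a1 * X1 + a2 * X2 \<and> W = b1 * X1 + b2 * X2) \<and>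
     (\<forall>lam x10 x20 y0 w0.
        lambda_relations r lam \<and>
        y0 = a1 * x10 + a2 * x20 \<and> w0 = b1 * x10 + b2 * x20 \<and>
        y0 \<noteq> 0 \<and> (\<forall>j. w0 / y0 \<noteq> r$j) \<longrightarrow>
        (\<exists>R>0. (\<exists>y. explicit_y y0 (ball 0 R) y) \<and> (\<exists>u. implicit_u r lam y0 w0 (ball 0 R) u)) \<and>
        (\<forall>D. time_domain D \<longrightarrow>
           (\<forall>u v. implicit_u r lam y0 w0 D u \<and> implicit_u r lam y0 w0 D v \<longrightarrow>
              (\<forall>t\<in>D. u t = v t)) \<and>
           (\<forall>x1 x2.
              solves_cubic_system C D x1 x2 \<and> x1 0 = x10 \<and> x2 0 = x20
              \<longleftrightarrow>
              (\<exists>y w u. explicit_y y0 D y \<and> implicit_u r lam y0 w0 D u \<and>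
                 (\<forall>t\<in>D. w t = u t * y t \<and>
                    x1 t = (b2 * y t - a2 * w t) / c \<and>
                    x2 t = - (b1 * y t - a1 * w t) / c)))))"
proof -
  define F1 where "F1 X1 X2 = C$1$1 * X1 ^ 3 + C$1$2 * X1 ^ 2 * X2 + C$1$3 * X1 * X2 ^ 2 + C$1$4 * X2 ^ 3" for X1 X2
  define F2 where "F2 X1 X2 = C$2$1 * X1 ^ 3 + C$2$2 * X1 ^ 2 * X2 + C$2$3 * X1 * X2 ^ 2 + C$2$4 * X2 ^ 3" for X1 X2
  \<comment> \<open>The cubic form with \<open>G Y (z Y) = Y\<^sup>3 (p z + z)\<close>, \<open>p\<close> the given cubic polynomial: the extra \<open>z\<close>,
    which is the reason for \<open>g2 - 1\<close> in \<open>p\<close>, is consumed by \<open>u y'\<close> in \<open>w' = u' y + u y'\<close>.\<close>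
  define G where "G Y W = W ^ 3 + g1 * Y * W ^ 2 + g2 * Y ^ 2 * W + g3 * Y ^ 3" for Y W
  have g3: "g3 = - (r$1 * r$2 * r$3)"
    using roots[of 0] by simp
  have at1: "g1 + g2 + g3 = (1 - r$1) * (1 - r$2) * (1 - r$3)"
    using roots[of 1] by simp
  moreover have "g1 - g2 + g3 = - ((1 + r$1) * (1 + r$2) * (1 + r$3))"
    using roots[of "- 1"] by (simp add: algebra_simps)
  ultimately have "2 * g1 = 2 * - (r$1 + r$2 + r$3)"
    using g3 by algebra
  then have g1: "g1 = - (r$1 + r$2 + r$3)"
    unfolding mult_cancel_left by simp
  have g2: "g2 = r$1 * r$2 + r$2 * r$3 + r$3 * r$1 + 1"
    using at1 g1 g3 by algebra
  have inversion: "X1 = (b2 * Y - a2 * W) / c \<and> X2 = - (b1 * Y - a1 * W) / c \<longleftrightarrow>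
      Y = a1 * X1 + a2 * X2 \<and> W = b1 * X1 + b2 * X2" for X1 X2 Y W
  proof -
    have "X1 = (b2 * Y - a2 * W) / c \<longleftrightarrow> X1 * c = b2 * Y - a2 * W"
      and "X2 = - (b1 * Y - a1 * W) / c \<longleftrightarrow> X2 * c = - (b1 * Y - a1 * W)"
      by (rule nonzero_eq_divide_eq[OF c_nonzero])+
    moreover have "Y = a1 * X1 + a2 * X2 \<and> W = b1 * X1 + b2 * X2"
      if "X1 * c = b2 * Y - a2 * W" "X2 * c = - (b1 * Y - a1 * W)"
    proof -
      have "c * Y = c * (a1 * X1 + a2 * X2)"
        using that unfolding c by algebra
      moreover have "c * W = c * (b1 * X1 + b2 * X2)"
        using that unfolding c by algebra
      ultimately show ?thesis
        unfolding mult_cancel_left using c_nonzero by simp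
    qed
    moreover have "X1 * c = b2 * Y - a2 * W" "X2 * c = - (b1 * Y - a1 * W)"
      if "Y = a1 * X1 + a2 * X2" "W = b1 * X1 + b2 * X2"
      unfolding that c by algebra+
    ultimately show ?thesis by blast
  qed
  have cC: "c * C$1$1 = a1^3 * b2 - a2 * K1" "c * C$2$1 = - (a1^3) * b1 + a1 * K1"
    "c * C$1$2 = 3 * a1^2 * a2 * b2 - a2 * K2" "c * C$2$2 = - 3 * a1^2 * a2 * b1 + a1 * K2"
    "c * C$1$3 = 3 * a1 * a2^2 * b2 - a2 * K3" "c * C$2$3 = - 3 * a1 * a2^2 * b1 + a1 * K3"
    "c * C$1$4 = a2^3 * b2 - a2 * K4" "c * C$2$4 = - (a2^3) * b1 + a1 * K4"
    using c_nonzero by (simp_all add: c11 c21 c12 c22 c13 c23 c14 c24)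
  have K: "K1 * X1 ^ 3 + K2 * X1 ^ 2 * X2 + K3 * X1 * X2 ^ 2 + K4 * X2 ^ 3 =
      G (a1 * X1 + a2 * X2) (b1 * X1 + b2 * X2)" for X1 X2
    unfolding G_def K1 K2 K3 K4 by algebra
  have F: "F1 X1 X2 = (b2 * Y ^ 3 - a2 * G Y W) / c" "F2 X1 X2 = - (b1 * Y ^ 3 - a1 * G Y W) / c"
    if Y: "Y = a1 * X1 + a2 * X2" and W: "W = b1 * X1 + b2 * X2" for X1 X2 Y W
  proof -
    have "c * F1 X1 X2 = c * C$1$1 * X1 ^ 3 + c * C$1$2 * X1 ^ 2 * X2 + c * C$1$3 * X1 * X2 ^ 2
        + c * C$1$4 * X2 ^ 3"
      unfolding F1_def by (simp add: algebra_simps)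
    also have "\<dots> = b2 * Y ^ 3 - a2 * G Y W"
      unfolding cC Y W K[symmetric] by algebra
    finally show "F1 X1 X2 = (b2 * Y ^ 3 - a2 * G Y W) / c"
      by (simp only: nonzero_eq_divide_eq[OF c_nonzero] mult.commute)
    have "c * F2 X1 X2 = c * C$2$1 * X1 ^ 3 + c * C$2$2 * X1 ^ 2 * X2 + c * C$2$3 * X1 * X2 ^ 2
        + c * C$2$4 * X2 ^ 3"
      unfolding F2_def by (simp add: algebra_simps)
    also have "\<dots> = - (b1 * Y ^ 3 - a1 * G Y W)"
      unfolding cC Y W K[symmetric] by algebra
    finally show "F2 X1 X2 = - (b1 * Y ^ 3 - a1 * G Y W) / c"
      by (simp only: nonzero_eq_divide_eq[OF c_nonzero] mult.commute)
  qed
  have G_root: "G Y (z * Y) = Y ^ 3 * ((z - r$1) * (z - r$2) * (z - r$3) + z)" for Y z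
    unfolding G_def roots[symmetric] by algebra
  have roots_set: "{r$1, r$2, r$3} = cardano_roots g1 S T"
    if "cardano_radicals g1 (g2 - 1) g3 S T" for S T
    using cardano_roots_iff[OF that] unfolding roots by auto
  have solution_iff: "solves_cubic_system C D x1 x2 \<and> x1 0 = x10 \<and> x2 0 = x20 \<longleftrightarrow>
      (\<exists>y w u. explicit_y y0 D y \<and> implicit_u r lam y0 w0 D u \<and>
         (\<forall>t\<in>D. w t = u t * y t \<and>
            x1 t = (b2 * y t - a2 * w t) / c \<and> x2 t = - (b1 * y t - a1 * w t) / c))"
    if lam: "lambda_relations r lam"
      and y0: "y0 = a1 * x10 + a2 * x20" and w0: "w0 = b1 * x10 + b2 * x20"
      and y0_nz: "y0 \<noteq> 0" and u0: "\<And>j. w0 / y0 \<noteq> r$j" and D: "time_domain D"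
    for lam x10 x20 y0 w0 D x1 x2
  proof
    assume "solves_cubic_system C D x1 x2 \<and> x1 0 = x10 \<and> x2 0 = x20"
    then have init: "x1 0 = x10" "x2 0 = x20"
      and x1: "\<And>t. t \<in> D \<Longrightarrow> (x1 has_field_derivative F1 (x1 t) (x2 t)) (at t within D)"
      and x2: "\<And>t. t \<in> D \<Longrightarrow> (x2 has_field_derivative F2 (x1 t) (x2 t)) (at t within D)"
      unfolding solves_cubic_system_def F1_def F2_def by auto
    define y where "y t = a1 * x1 t + a2 * x2 t" for t
    define w where "w t = b1 * x1 t + b2 * x2 t" for t
    have yd: "(y has_field_derivative y t ^ 3) (at t within D)"
      and wd: "(w has_field_derivative G (y t) (w t)) (at t within D)" if t: "t \<in> D" for t
    proof -
      have "F1 (x1 t) (x2 t) = (b2 * y t ^ 3 - a2 * G (y t) (w t)) / c \<and>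
          F2 (x1 t) (x2 t) = - (b1 * y t ^ 3 - a1 * G (y t) (w t)) / c"
        using F[OF y_def w_def] by blast
      then have d: "y t ^ 3 = a1 * F1 (x1 t) (x2 t) + a2 * F2 (x1 t) (x2 t)"
          "G (y t) (w t) = b1 * F1 (x1 t) (x2 t) + b2 * F2 (x1 t) (x2 t)"
        unfolding inversion by blast+
      show "(y has_field_derivative y t ^ 3) (at t within D)"
        "(w has_field_derivative G (y t) (w t)) (at t within D)"
        unfolding d using x1[OF t] x2[OF t] unfolding y_def w_def
        by (auto intro!: derivative_eq_intros)
    qed
    have y_init: "y 0 = y0" and w_init: "w 0 = w0"
      by (simp_all add: y_def w_def y0 w0 init)
    have y: "explicit_y y0 D y"
      using yd y_init explicit_y_iff_ode[OF D] by blast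
    have y_nz: "y t \<noteq> 0" if "t \<in> D" for t
      by (rule explicit_y_nonzero[OF y that y0_nz])
    define u where "u t = w t / y t" for t
    have "(u has_field_derivative
        y t ^ 2 * ((u t - r$1) * (u t - r$2) * (u t - r$3))) (at t within D)" if t: "t \<in> D" for t
    proof -
      have wu: "w t = u t * y t"
        using y_nz[OF t] by (simp add: u_def)
      have "(G (y t) (w t) * y t - w t * y t ^ 3) / (y t * y t) =
          y t ^ 2 * ((u t - r$1) * (u t - r$2) * (u t - r$3))"
        unfolding wu G_root using y_nz[OF t]
        by (simp add: divide_eq_eq) algebra
      with DERIV_divide[OF wd[OF t] yd[OF t] y_nz[OF t]] show ?thesis
        unfolding u_def by simp
    qed
    then have "implicit_u r lam y0 w0 D u"
      unfolding implicit_u_iff_ode[OF D lam y u0] using y_init w_init by (simp add: u_def)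
    moreover have "\<forall>t\<in>D. w t = u t * y t \<and>
        x1 t = (b2 * y t - a2 * w t) / c \<and> x2 t = - (b1 * y t - a1 * w t) / c"
      using y_nz unfolding inversion by (simp add: u_def y_def w_def)
    ultimately show "\<exists>y w u. explicit_y y0 D y \<and> implicit_u r lam y0 w0 D u \<and>
        (\<forall>t\<in>D. w t = u t * y t \<and>
           x1 t = (b2 * y t - a2 * w t) / c \<and> x2 t = - (b1 * y t - a1 * w t) / c)"
      using y by blast
  next
    assume "\<exists>y w u. explicit_y y0 D y \<and> implicit_u r lam y0 w0 D u \<and>
        (\<forall>t\<in>D. w t = u t * y t \<and>
           x1 t = (b2 * y t - a2 * w t) / c \<and> x2 t = - (b1 * y t - a1 * w t) / c)"
    then obtain y w u where y: "explicit_y y0 D y" and u: "implicit_u r lam y0 w0 D u"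
      and w: "\<And>t. t \<in> D \<Longrightarrow> w t = u t * y t"
      and x: "\<And>t. t \<in> D \<Longrightarrow> x1 t = (b2 * y t - a2 * w t) / c \<and> x2 t = - (b1 * y t - a1 * w t) / c"
      by blast
    have y_init: "y 0 = y0"
      and yd: "\<And>t. t \<in> D \<Longrightarrow> (y has_field_derivative y t ^ 3) (at t within D)"
      using y explicit_y_iff_ode[OF D] by auto
    have u_init: "u 0 = w0 / y0"
      and ud: "\<And>t. t \<in> D \<Longrightarrow> (u has_field_derivative
        y t ^ 2 * ((u t - r$1) * (u t - r$2) * (u t - r$3))) (at t within D)"
      using u unfolding implicit_u_iff_ode[OF D lam y u0] by auto
    have wd: "(w has_field_derivative G (y t) (w t)) (at t within D)" if t: "t \<in> D" for t
    proof -
      have "((\<lambda>t. u t * y t) has_field_derivative G (y t) (w t)) (at t within D)"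
        using DERIV_mult[OF ud[OF t] yd[OF t]]
        unfolding w[OF t] G_root by (rule DERIV_cong) algebra
      then show ?thesis
        by (rule has_field_derivative_transform_within[OF _ zero_less_one t]) (simp add: w)
    qed
    have "(x1 has_field_derivative F1 (x1 t) (x2 t)) (at t within D) \<and>
        (x2 has_field_derivative F2 (x1 t) (x2 t)) (at t within D)" if t: "t \<in> D" for t
    proof -
      have "y t = a1 * x1 t + a2 * x2 t" "w t = b1 * x1 t + b2 * x2 t"
        using x[OF t] unfolding inversion by blast+
      note F' = F[OF this]
      have "((\<lambda>t. (b2 * y t - a2 * w t) / c) has_field_derivative F1 (x1 t) (x2 t)) (at t within D)"
        and "((\<lambda>t. - (b1 * y t - a1 * w t) / c) has_field_derivative F2 (x1 t) (x2 t)) (at t within D)"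
        unfolding F' using yd[OF t] wd[OF t] c_nonzero by (auto intro!: derivative_eq_intros)
      then show ?thesis
        using x by (auto intro: has_field_derivative_transform_within[OF _ zero_less_one t])
    qed
    then have "solves_cubic_system C D x1 x2"
      unfolding solves_cubic_system_def F1_def F2_def by blast
    moreover have "x1 0 = x10 \<and> x2 0 = x20"
    proof -
      have "w 0 = w0"
        using w[OF time_domain_0[OF D]] u_init y_init y0_nz by simp
      then have "x1 0 = (b2 * y0 - a2 * w0) / c \<and> x2 0 = - (b1 * y0 - a1 * w0) / c"
        using x[OF time_domain_0[OF D]] y_init by simp
      moreover have "x10 = (b2 * y0 - a2 * w0) / c \<and> x20 = - (b1 * y0 - a1 * w0) / c"
        unfolding inversion using y0 w0 by blast
      ultimately show ?thesis by simp
    qed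
    ultimately show "solves_cubic_system C D x1 x2 \<and> x1 0 = x10 \<and> x2 0 = x20"
      by blast
  qed
  show ?thesis
  proof (intro conjI allI impI)
    fix lam x10 x20 y0 w0
    assume *: "lambda_relations r lam \<and>
        y0 = a1 * x10 + a2 * x20 \<and> w0 = b1 * x10 + b2 * x20 \<and>
        y0 \<noteq> 0 \<and> (\<forall>j. w0 / y0 \<noteq> r$j)"
    then have u0: "\<And>j. w0 / y0 \<noteq> r$j" and lam: "lambda_relations r lam" by blast+
    show "\<exists>R>0. (\<exists>y. explicit_y y0 (ball 0 R) y) \<and> (\<exists>u. implicit_u r lam y0 w0 (ball 0 R) u)"
      by (rule local_existence[OF lam u0])
    fix D assume D: "time_domain D"
    show "\<forall>t\<in>D. u t = v t"
      if "implicit_u r lam y0 w0 D u \<and> implicit_u r lam y0 w0 D v" for u v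
      using that implicit_u_unique[OF D lam u0] by blast
    show "solves_cubic_system C D x1 x2 \<and> x1 0 = x10 \<and> x2 0 = x20 \<longleftrightarrow>
      (\<exists>y w u. explicit_y y0 D y \<and> implicit_u r lam y0 w0 D u \<and>
         (\<forall>t\<in>D. w t = u t * y t \<and>
            x1 t = (b2 * y t - a2 * w t) / c \<and> x2 t = - (b1 * y t - a1 * w t) / c))" for x1 x2
      using * by (intro solution_iff[OF lam _ _ _ u0 D]) blast+
  qed (use g1 g2 g3 inversion roots_set cardano_radicals_exist lambda_relations_ex1[OF roots_distinct]
      lambda_relations_iff[OF roots_distinct] in auto)
qed

end
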